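(* Let $k\le 12$, let $m$ be a positive integer all of whose prime factors are larger than $k!$, and let $S$ be a subset of $D_{2m}\setminus\{\mathrm{id}\}$ with $|S|=k$. \begin{enumerate} \item If $S$ is not of type $(k,0)$, then $S$ has a linear sequencing. \item Consequently, if there is at least one ordering $x_1,\dots,x_k$ of the elements of $S$ with $x_1x_2\cdots x_k\neq\mathrm{id}$, then $S$ has a linear sequencing. \end{enumerate}
   Context: $D_{2m}$ is the dihedral group of order $2m$, i.e. $\mathbb{Z}_m\rtimes\mathbb{Z}_2$ with product $(x,a)(y,b)=(x+(-1)^a y,\,a+b)$. The type of a subset $S$ of $D_{2m}$ is $(\lambda_0,\lambda_1)$, where $\lambda_i$ is the number of elements of $S$ whose second coordinate equals $i$. Let $G$ be a group and $S\subseteq G\setminus\{\mathrm{id}_G\}$ a finite subset with $|S|=k$. For an ordering $x_1,\dots,x_k$ of the elements of $S$ (each used exactly once), the partial sums are $s_0=\mathrm{id}_G$ and $s_j=x_1x_2\cdots x_j$ for $0<j\le k$. The ordering is a linear sequencing if $s_0,s_1,\dots,s_k$ are all different. *)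

theory Defs
  imports "HOL-Algebra.Group" "HOL-Combinatorics.Multiset_Permutations"
    "HOL-Computational_Algebra.Primes"
begin

text \<open>
  Elements of \<open>\<int>\<^sub>m\<close> and \<open>\<int>\<^sub>2\<close> are represented by their least nonnegative residues. The definition
  is meant for \<open>m > 0\<close>; for \<open>m = 0\<close> the carrier is empty.
\<close>

definition dihedral_group :: "nat \<Rightarrow> (int \<times> nat) monoid" where
  "dihedral_group m =
     \<lparr>carrier = {0..<int m} \<times> {0..<2},
      monoid.mult = (\<lambda>(x, a) (y, b). ((x + (-1) ^ a * y) mod int m, (a + b) mod 2)),
      one = (0, 0)\<rparr>"

definition dihedral_type :: "(int \<times> nat) set \<Rightarrow> nat \<times> nat" where
  "dihedral_type S = (card {s \<in> S. snd s = 0}, card {s \<in> S. snd s = 1})"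

definition partial_product :: "('a, 'b) monoid_scheme \<Rightarrow> 'a list \<Rightarrow> nat \<Rightarrow> 'a" where
  "partial_product G xs j = foldr (monoid.mult G) (take j xs) \<one>\<^bsub>G\<^esub>"

definition linear_sequencing :: "('a, 'b) monoid_scheme \<Rightarrow> 'a set \<Rightarrow> 'a list \<Rightarrow> bool" where
  "linear_sequencing G S xs \<longleftrightarrow>
     xs \<in> permutations_of_set S \<and> inj_on (partial_product G xs) {0..card S}"

lemma group_dihedral_group:
  assumes "m > 0"
  shows "group (dihedral_group m)"
proof (rule groupI)
  fix u v assume "u \<in> carrier (dihedral_group m)" "v \<in> carrier (dihedral_group m)"
  then show "u \<otimes>\<^bsub>dihedral_group m\<^esub> v \<in> carrier (dihedral_group m)"
    using assms by (auto simp: dihedral_group_def)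
next
  show "\<one>\<^bsub>dihedral_group m\<^esub> \<in> carrier (dihedral_group m)"
    using assms by (auto simp: dihedral_group_def)
next
  fix u v w assume "u \<in> carrier (dihedral_group m)" "v \<in> carrier (dihedral_group m)"
    "w \<in> carrier (dihedral_group m)"
  then show "u \<otimes>\<^bsub>dihedral_group m\<^esub> v \<otimes>\<^bsub>dihedral_group m\<^esub> w =
      u \<otimes>\<^bsub>dihedral_group m\<^esub> (v \<otimes>\<^bsub>dihedral_group m\<^esub> w)"
    by (auto simp: dihedral_group_def less_2_cases_iff mod_simps algebra_simps)
next
  fix u assume "u \<in> carrier (dihedral_group m)"
  then show "\<one>\<^bsub>dihedral_group m\<^esub> \<otimes>\<^bsub>dihedral_group m\<^esub> u = u"
    by (auto simp: dihedral_group_def)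
next
  fix u assume u: "u \<in> carrier (dihedral_group m)"
  obtain x a where xa: "u = (x, a)" by (cases u)
  show "\<exists>v\<in>carrier (dihedral_group m). v \<otimes>\<^bsub>dihedral_group m\<^esub> u = \<one>\<^bsub>dihedral_group m\<^esub>"
  proof (cases "a = 0")
    case True
    then show ?thesis using u xa assms
      by (intro bexI[of _ "((- x) mod int m, 0)"]) (auto simp: dihedral_group_def mod_simps)
  next
    case False
    then show ?thesis using u xa
      by (intro bexI[of _ u]) (auto simp: dihedral_group_def less_2_cases_iff)
  qed
qed

end

theory Submission
  imports Defs "Jordan_Normal_Form.Determinant"
begin

text \<open>
  An ordering fails to be a linear sequencing exactly when some nonempty contiguous block multiplies
  to the identity. In the dihedral group this means that the block contains an even number of
  reflections and that a certain signed sum of its first coordinates, with all coefficients in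
  \<open>{-1, 0, 1}\<close>, vanishes modulo \<open>m\<close>. The proof has two independent halves.

  The residues can be replaced by integers \<open>y s\<close> satisfying exactly the same relations with
  coefficients in \<open>{-1, 0, 1}\<close> (lemma \<open>lift_relations\<close>). The reason is that a square matrix of size
  \<open>k\<close> with entries in \<open>{-1, 0, 1}\<close> has a determinant of absolute value at most \<open>k!\<close>; if nonzero, it is
  therefore coprime to \<open>m\<close>, so Cramer's rule can be used modulo \<open>m\<close> as well as over the rationals.

  Over the integers suitable orderings can be written down. Suppose first that there is a reflection
  (lemma \<open>ordering_with_reflection\<close>). Conjugation by translations shifts the coordinates of
  all reflections simultaneously, so it may be assumed that about half of them are positive and the
  others negative. While an even number of reflections has been used, multiplying by a positive
  element increases the first coordinate; while that number is odd, multiplying by a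
  negative element increases it. So take the positive rotations, a positive reflection, the negative
  rotations, and from there on alternately negative and positive reflections: the first coordinate of
  the partial product increases at every step.

  If all elements are rotations with nonzero sum (lemma \<open>ordering_of_rotations\<close>), put the positive ones
  before the negative ones. Only a block straddling the change of sign can have sum zero, so the
  positive and negative elements, both read outwards from that point, must never have
  equal absolute prefix sums. As the elements are distinct and the totals differ, an
  induction that removes the outermost element on the side with the larger total finds such orders.
\<close>

section \<open>Lifting from residues to integers\<close>

text \<open>The index \<open>i\<close> of \<open>v i r\<close> is the column, so that exchanging a column is a function update.\<close>

definition column_det :: "nat \<Rightarrow> (nat \<Rightarrow> nat \<Rightarrow> 'a :: comm_ring_1) \<Rightarrow> 'a" where
  "column_det n v = det (mat n n (\<lambda>(r, i). v i r))"

text \<open>Each of the \<open>n!\<close> terms of the Leibniz formula is at most 1 in absolute value.\<close>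

lemma column_det_bound:
  fixes v :: "nat \<Rightarrow> nat \<Rightarrow> int"
  assumes "\<And>i r. i < n \<Longrightarrow> r < n \<Longrightarrow> \<bar>v i r\<bar> \<le> 1"
  shows "\<bar>column_det n v\<bar> \<le> fact n"
proof -
  let ?M = "mat n n (\<lambda>(r, i). v i r)"
  have "\<bar>\<Prod>i = 0..<n. ?M $$ (i, p i)\<bar> \<le> 1" if p: "p permutes {0..<n}" for p
  proof -
    have "p i < n" if "i < n" for i
      using permutes_in_image[OF p, of i] that by simp
    then show ?thesis
      unfolding abs_prod by (intro prod_le_1) (auto intro: assms)
  qed
  then have "\<bar>signof p * (\<Prod>i = 0..<n. ?M $$ (i, p i))\<bar> \<le> 1" if "p permutes {0..<n}" for p
    using that by (auto simp: abs_mult sign_def)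
  then have "\<bar>column_det n v\<bar> \<le> (\<Sum>p\<in>{p. p permutes {0..<n}}. 1)"
    unfolding column_det_def det_def'[of ?M n, simplified]
    by (intro order_trans[OF sum_abs] sum_mono) auto
  also have "\<dots> = fact n"
    by (simp add: card_permutations)
  finally show ?thesis .
qed

lemma column_det_unit:
  "column_det n (\<lambda>i r. if i = r then 1 else 0) = (1 :: 'a :: comm_ring_1)"
proof -
  have "mat n n (\<lambda>(r, i). if i = r then 1 else (0 :: 'a)) = 1\<^sub>m n"
    by (intro eq_matI) auto
  then show ?thesis by (simp add: column_det_def)
qed

text \<open>
  As the cofactors of column \<open>i\<close> do not involve that column, this exhibits the determinant as a linear
  form in the new column \<open>l\<close>, with coefficients depending only on \<open>v\<close>.
\<close>

lemma column_det_expand: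
  fixes v :: "nat \<Rightarrow> nat \<Rightarrow> 'a :: comm_ring_1"
  assumes "i < n"
  shows "column_det n (v(i := l)) = (\<Sum>r<n. l r * cofactor (mat n n (\<lambda>(r, i). v i r)) r i)"
proof -
  let ?M = "mat n n (\<lambda>(r, j). v j r)"
  let ?N = "mat n n (\<lambda>(r, j). (v(i := l)) j r)"
  have "mat_delete ?N r i = mat_delete ?M r i" if "r < n" for r
    using that assms by (intro eq_matI) (auto simp: mat_delete_def)
  then have "cofactor ?N r i = cofactor ?M r i" if "r < n" for r
    using that by (simp add: cofactor_def)
  then show ?thesis
    unfolding column_det_def
    by (subst laplace_expansion_column[of _ n i]) (use assms in auto)
qed

text \<open>
  Cramer's rule without division, hence meaningful for integer matrices: up to the factor
  \<open>column_det n v\<close>, the vector \<open>l\<close> is a combination of the columns.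
\<close>

lemma column_det_cramer:
  fixes v :: "nat \<Rightarrow> nat \<Rightarrow> 'a :: comm_ring_1"
  assumes "r < n"
  shows "column_det n v * l r = (\<Sum>i<n. column_det n (v(i := l)) * v i r)"
proof -
  let ?M = "mat n n (\<lambda>(r, j). v j r)"
  have M: "?M \<in> carrier_mat n n" by simp
  have *: "(\<Sum>i<n. v i r * cofactor ?M q i) = (if q = r then column_det n v else 0)" if "q < n" for q
  proof -
    have "(\<Sum>i<n. v i r * cofactor ?M q i) = (?M * adj_mat ?M) $$ (r, q)"
      using that assms
      by (simp add: adj_mat_def scalar_prod_def lessThan_atLeast0)
    also have "\<dots> = (if q = r then column_det n v else 0)"
      unfolding adj_mat(2)[OF M] using that assms by (simp add: column_det_def)
    finally show ?thesis .
  qed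
  have "(\<Sum>i<n. column_det n (v(i := l)) * v i r)
      = (\<Sum>i<n. \<Sum>q<n. l q * (v i r * cofactor ?M q i))"
    by (intro sum.cong refl) (simp add: column_det_expand sum_distrib_left sum_distrib_right mult_ac)
  also have "\<dots> = (\<Sum>q<n. l q * (\<Sum>i<n. v i r * cofactor ?M q i))"
    by (subst sum.swap) (simp add: sum_distrib_left)
  also have "\<dots> = (\<Sum>q<n. l q * (if q = r then column_det n v else 0))"
    by (intro sum.cong refl) (simp add: *)
  also have "\<dots> = column_det n v * l r"
    using assms by (simp add: if_distrib sum.delta mult_ac cong: if_cong)
  finally show ?thesis ..
qed

text \<open>
  Uniqueness of digits to base \<open>b\<close>. The powers of \<open>b\<close> thus form a generic vector: no nonzero vector
  with small entries is orthogonal to it.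
\<close>

lemma digits_zero:
  fixes c :: "nat \<Rightarrow> int" and b :: int
  assumes "\<And>i. i < n \<Longrightarrow> \<bar>c i\<bar> < b" and "(\<Sum>i<n. c i * b ^ i) = 0" and "i < n"
  shows "c i = 0"
  using assms
proof (induction n arbitrary: c i)
  case (Suc n)
  have b: "b > 0" using Suc.prems(1)[of 0] by simp
  have eq: "c 0 + b * (\<Sum>i<n. c (Suc i) * b ^ i) = 0"
    using Suc.prems(2) by (simp add: sum.lessThan_Suc_shift sum_distrib_left mult_ac del: sum.lessThan_Suc)
  then have "b dvd c 0"
    by (metis dvd_0_right dvd_add_left_iff dvd_triv_left)
  then have c0: "c 0 = 0"
    using Suc.prems(1)[of 0] dvd_imp_le_int[of "c 0" b] by auto
  then have "(\<Sum>i<n. c (Suc i) * b ^ i) = 0" using eq b by simp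
  then have "c (Suc j) = 0" if "j < n" for j
    using Suc.IH[of "\<lambda>i. c (Suc i)" j] Suc.prems(1) that by simp
  then show ?case using c0 Suc.prems(3) by (cases i) auto
qed simp

lemma coprime_of_small:
  fixes d :: int
  assumes "\<And>p :: nat. prime p \<Longrightarrow> p dvd m \<Longrightarrow> p > b" and "d \<noteq> 0" and "\<bar>d\<bar> \<le> int b"
  shows "coprime (int m) d"
proof -
  have "coprime m (nat \<bar>d\<bar>)"
  proof (rule ccontr)
    assume "\<not> coprime m (nat \<bar>d\<bar>)"
    then obtain p where p: "prime p" "p dvd gcd m (nat \<bar>d\<bar>)"
      using prime_factor_nat[of "gcd m (nat \<bar>d\<bar>)"] by (metis coprime_iff_gcd_eq_1)
    then have pm: "p dvd m" and pd: "p dvd nat \<bar>d\<bar>" using gcd_greatest_iff by blast+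
    have "p \<le> nat \<bar>d\<bar>" using assms(2) by (intro dvd_imp_le pd) auto
    then show False using assms(1)[OF p(1) pm] assms(3) by linarith
  qed
  then show ?thesis
    by (metis coprime_int_iff abs_ge_zero coprime_abs_right_iff int_nat_eq)
qed

text \<open>
  Call a vector with entries in \<open>{-1, 0, 1}\<close> a relation if it annihilates \<open>x\<close> modulo \<open>m\<close>. Among the
  nonsingular matrices with entries in \<open>{-1, 0, 1}\<close> choose one with as many relations among its columns
  as possible, say at the positions \<open>J\<close>. By Cramer's rule the coefficients of a vector \<open>l\<close> with
  respect to these columns are, up to a common factor, the determinants \<open>?d i l\<close>. If \<open>l\<close> is a
  relation, they vanish outside \<open>J\<close>, since otherwise \<open>l\<close> could replace a column outside \<open>J\<close>.
  Conversely, if they vanish outside \<open>J\<close>, then a multiple of \<open>l\<close> by a number coprime to \<open>m\<close> is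
  an integer combination of relations, so \<open>l\<close> is a relation. It remains to choose \<open>y\<close> as a generic
  vector on which \<open>l\<close> takes a value depending only on the coefficients outside \<open>J\<close>.
\<close>

lemma lift_relations_nat:
  fixes x :: "nat \<Rightarrow> int"
  assumes "\<And>p :: nat. prime p \<Longrightarrow> p dvd m \<Longrightarrow> p > fact n"
  shows "\<exists>y :: nat \<Rightarrow> int. \<forall>l. (\<forall>i<n. \<bar>l i\<bar> \<le> 1) \<longrightarrow>
    ((\<Sum>i<n. l i * y i) = 0 \<longleftrightarrow> int m dvd (\<Sum>i<n. l i * x i))"
proof -
  define E :: "(nat \<Rightarrow> int) set" where "E = {l. \<forall>i<n. \<bar>l i\<bar> \<le> 1}"
  define R where "R = {l \<in> E. int m dvd (\<Sum>i<n. l i * x i)}"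
  define ok where "ok = (\<lambda>(v, J). J \<subseteq> {..<n} \<and> (\<forall>i<n. v i \<in> E) \<and> (\<forall>i\<in>J. v i \<in> R) \<and> column_det n v \<noteq> 0)"
  have "ok (\<lambda>i r. if i = r then 1 else 0, {})"
    by (auto simp: ok_def E_def column_det_unit)
  moreover have "\<forall>vJ. ok vJ \<longrightarrow> card (snd vJ) < Suc n"
    using card_mono[of "{..<n}"] by (fastforce simp: ok_def)
  ultimately obtain vJ where vJ: "ok vJ" "\<forall>wK. ok wK \<longrightarrow> card (snd wK) \<le> card (snd vJ)"
    using ex_has_greatest_nat[of ok _ "\<lambda>vJ. card (snd vJ)" "Suc n"] by blast
  obtain v J where "vJ = (v, J)" by (cases vJ)
  with vJ have J: "J \<subseteq> {..<n}" and vE: "\<And>i. i < n \<Longrightarrow> v i \<in> E" and vR: "\<And>i. i \<in> J \<Longrightarrow> v i \<in> R"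
    and nz: "column_det n v \<noteq> 0" and max: "\<And>w K. ok (w, K) \<Longrightarrow> card K \<le> card J"
    by (auto simp: ok_def)
  have finJ: "finite J" using J finite_subset by blast
  let ?d = "\<lambda>i l. column_det n (v(i := l))"
  let ?C = "\<lambda>r i. cofactor (mat n n (\<lambda>(r, i). v i r)) r i"
  define b :: int where "b = fact n + 1"
  \<comment> \<open>The adjugate matrix turns the pairing with \<open>y\<close> into a pairing of the Cramer coefficients
    outside \<open>J\<close> with the powers of \<open>b\<close>; see \<open>ly\<close>.\<close>
  define y where "y = (\<lambda>r. \<Sum>i<n. if i \<in> J then 0 else b ^ i * ?C r i)"
  have bound: "\<bar>?d i l\<bar> \<le> fact n" if "i < n" "l \<in> E" for i l
    using vE that by (intro column_det_bound) (auto simp: E_def)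
  have R0: "?d i l = 0" if "l \<in> R" "i < n" "i \<notin> J" for i l
  proof (rule ccontr)
    assume "?d i l \<noteq> 0"
    then have "ok (v(i := l), insert i J)"
      using that J vE vR by (auto simp: ok_def R_def)
    from max[OF this] show False using that finJ by simp
  qed
  have ly: "(\<Sum>r<n. l r * y r) = (\<Sum>i<n. (if i \<in> J then 0 else ?d i l) * b ^ i)" for l
  proof -
    have "(\<Sum>r<n. l r * y r) = (\<Sum>r<n. \<Sum>i<n. (if i \<in> J then 0 else l r * ?C r i) * b ^ i)"
      unfolding y_def sum_distrib_left by (intro sum.cong refl) (auto simp: mult_ac)
    also have "\<dots> = (\<Sum>i<n. \<Sum>r<n. (if i \<in> J then 0 else l r * ?C r i) * b ^ i)"
      by (rule sum.swap)
    also have "\<dots> = (\<Sum>i<n. (if i \<in> J then 0 else ?d i l) * b ^ i)"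
      by (intro sum.cong refl) (auto simp: column_det_expand sum_distrib_right)
    finally show ?thesis .
  qed
  have "(\<Sum>i<n. l i * y i) = 0 \<longleftrightarrow> int m dvd (\<Sum>i<n. l i * x i)" if l: "\<forall>i<n. \<bar>l i\<bar> \<le> 1" for l
  proof
    have lE: "l \<in> E" using l by (auto simp: E_def)
    assume "(\<Sum>i<n. l i * y i) = 0"
    then have "(if i \<in> J then 0 else ?d i l) = 0" if "i < n" for i
      using digits_zero[of n "\<lambda>i. if i \<in> J then 0 else ?d i l" b i] bound[OF _ lE] that
      by (force simp: ly b_def)
    then have d0: "?d i l = 0" if "i < n" "i \<notin> J" for i
      using that by metis
    have "column_det n v * (\<Sum>r<n. l r * x r) = (\<Sum>r<n. (\<Sum>i<n. ?d i l * v i r) * x r)"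
      unfolding sum_distrib_left
      by (intro sum.cong refl) (simp add: column_det_cramer[symmetric])
    also have "\<dots> = (\<Sum>i<n. ?d i l * (\<Sum>r<n. v i r * x r))"
      unfolding sum_distrib_left sum_distrib_right by (subst sum.swap) (simp add: mult_ac)
    also have "int m dvd \<dots>"
    proof (intro dvd_sum)
      fix i assume "i \<in> {..<n}"
      then show "int m dvd ?d i l * (\<Sum>r<n. v i r * x r)"
        using d0[of i] vR[of i] by (cases "i \<in> J") (auto simp: R_def)
    qed
    finally have "int m dvd column_det n v * (\<Sum>r<n. l r * x r)" .
    moreover have "coprime (int m) (column_det n v)"
      using column_det_bound[of n v] vE nz
      by (intro coprime_of_small[of m "fact n"] assms) (auto simp: E_def)
    ultimately show "int m dvd (\<Sum>r<n. l r * x r)"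
      using coprime_dvd_mult_right_iff by blast
  next
    assume "int m dvd (\<Sum>i<n. l i * x i)"
    then have "l \<in> R" using l by (auto simp: R_def E_def)
    then show "(\<Sum>i<n. l i * y i) = 0"
      unfolding ly by (intro sum.neutral) (auto simp: R0)
  qed
  then show ?thesis by blast
qed

lemma lift_relations:
  fixes x :: "'a \<Rightarrow> int"
  assumes "finite S" and "\<And>p :: nat. prime p \<Longrightarrow> p dvd m \<Longrightarrow> p > fact (card S)"
  shows "\<exists>y :: 'a \<Rightarrow> int. \<forall>l. (\<forall>s\<in>S. \<bar>l s\<bar> \<le> 1) \<longrightarrow>
    ((\<Sum>s\<in>S. l s * y s) = 0 \<longleftrightarrow> int m dvd (\<Sum>s\<in>S. l s * x s))"
proof -
  obtain h where h: "bij_betw h {..<card S} S"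
    using ex_bij_betw_nat_finite[OF assms(1)] by (auto simp: lessThan_atLeast0)
  define g where "g = inv_into {..<card S} h"
  have gh: "g (h i) = i" if "i < card S" for i
    using h that by (simp add: g_def bij_betw_inv_into_left)
  have hS: "h i \<in> S" if "i < card S" for i
    using h that by (auto simp: bij_betw_def)
  obtain y :: "nat \<Rightarrow> int" where y: "\<forall>l. (\<forall>i<card S. \<bar>l i\<bar> \<le> 1) \<longrightarrow>
      ((\<Sum>i<card S. l i * y i) = 0 \<longleftrightarrow> int m dvd (\<Sum>i<card S. l i * (x \<circ> h) i))"
    using lift_relations_nat[OF assms(2), where x = "x \<circ> h"] by blast
  have re: "(\<Sum>s\<in>S. f s) = (\<Sum>i<card S. f (h i))" for f :: "'a \<Rightarrow> int"
    using sum.reindex_bij_betw[OF h, of f] by simp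
  show ?thesis
  proof (intro exI[of _ "y \<circ> g"] allI impI)
    fix l :: "'a \<Rightarrow> int" assume "\<forall>s\<in>S. \<bar>l s\<bar> \<le> 1"
    then have "(\<Sum>i<card S. l (h i) * y i) = 0 \<longleftrightarrow> int m dvd (\<Sum>i<card S. l (h i) * x (h i))"
      using y[rule_format, of "l \<circ> h"] hS by simp
    moreover have "(\<Sum>i<card S. l (h i) * y (g (h i))) = (\<Sum>i<card S. l (h i) * y i)"
      by (intro sum.cong refl) (simp add: gh)
    ultimately show "(\<Sum>s\<in>S. l s * (y \<circ> g) s) = 0 \<longleftrightarrow> int m dvd (\<Sum>s\<in>S. l s * x s)"
      unfolding re comp_def by simp
  qed
qed

section \<open>Contiguous products in the dihedral group\<close>

text \<open>
  For \<open>f = fst\<close> this is, before reduction modulo \<open>m\<close>, the first coordinate of the product of the list: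
  each reflection inverts the sign of everything after it. A general weight \<open>f\<close> is needed
  for integers substituted for these coordinates.
\<close>

fun signed_sum :: "('a \<times> nat \<Rightarrow> int) \<Rightarrow> ('a \<times> nat) list \<Rightarrow> int" where
  "signed_sum f [] = 0"
| "signed_sum f (s # zs) = f s + (-1) ^ snd s * signed_sum f zs"

lemma foldr_dihedral:
  assumes "set zs \<subseteq> carrier (dihedral_group m)" and "m > 0"
  shows "foldr (monoid.mult (dihedral_group m)) zs \<one>\<^bsub>dihedral_group m\<^esub> =
    (signed_sum fst zs mod int m, sum_list (map snd zs) mod 2)"
  using assms(1)
proof (induction zs)
  case (Cons s zs)
  obtain x a where s: "s = (x, a)" by (cases s)
  have IH: "foldr (monoid.mult (dihedral_group m)) zs \<one>\<^bsub>dihedral_group m\<^esub> =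
    (signed_sum fst zs mod int m, sum_list (map snd zs) mod 2)"
    using Cons by simp
  have "a = 0 \<or> a = 1"
    using Cons.prems by (auto simp: s dihedral_group_def)
  then show ?case
    unfolding list.simps foldr.simps comp_def IH
    by (auto simp: s dihedral_group_def mod_simps)
qed (use assms(2) in \<open>auto simp: dihedral_group_def\<close>)

lemma (in monoid) foldr_mult_append:
  assumes "set us \<subseteq> carrier G" and "set zs \<subseteq> carrier G"
  shows "foldr (\<otimes>) (us @ zs) \<one> = foldr (\<otimes>) us \<one> \<otimes> foldr (\<otimes>) zs \<one>"
proof -
  have closed: "foldr (\<otimes>) ws \<one> \<in> carrier G" if "set ws \<subseteq> carrier G" for ws
    using that by (induction ws) auto
  show ?thesis
    using assms(1)
  proof (induction us)
    case Nil
    then show ?case using closed[OF assms(2)] by simp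
  next
    case (Cons u us)
    then show ?case
      using closed[OF assms(2)] closed[of us] by (simp add: m_assoc)
  qed
qed

text \<open>
  Cancelling the \<open>i\<close>-th partial product from the \<open>j\<close>-th leaves the product of the block between
  them, so two partial products agree only if a nonempty block has product one.
\<close>

lemma linear_sequencing_dihedralI:
  assumes "m > 0" and "S \<subseteq> carrier (dihedral_group m)" and xs: "xs \<in> permutations_of_set S"
    and zs: "\<And>us zs vs. xs = us @ zs @ vs \<Longrightarrow> zs \<noteq> [] \<Longrightarrow> even (sum_list (map snd zs)) \<Longrightarrow>
      \<not> int m dvd signed_sum fst zs"
  shows "linear_sequencing (dihedral_group m) S xs"
proof -
  interpret group "dihedral_group m" by (rule group_dihedral_group[OF assms(1)])
  let ?prod = "\<lambda>zs. foldr (monoid.mult (dihedral_group m)) zs \<one>\<^bsub>dihedral_group m\<^esub>"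
  have setxs: "set xs \<subseteq> carrier (dihedral_group m)"
    using xs assms(2) by (auto simp: permutations_of_set_def)
  have len: "length xs = card S"
    using xs by (auto simp: permutations_of_set_def distinct_card)
  have "partial_product (dihedral_group m) xs i \<noteq> partial_product (dihedral_group m) xs j"
    if ij: "i < j" "j \<le> card S" for i j
  proof
    assume eq: "partial_product (dihedral_group m) xs i = partial_product (dihedral_group m) xs j"
    define zs where "zs = drop i (take j xs)"
    have take: "take j xs = take i xs @ zs"
      unfolding zs_def using append_take_drop_id[of i "take j xs"] ij by (simp add: min_def)
    then have split: "xs = take i xs @ zs @ drop j xs"
      by (metis append.assoc append_take_drop_id)
    have sub: "set (take i xs) \<subseteq> carrier (dihedral_group m)" "set zs \<subseteq> carrier (dihedral_group m)"
      using setxs split by (metis set_take_subset subset_trans, metis Un_subset_iff set_append)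
    have closed: "?prod ws \<in> carrier (dihedral_group m)" if "set ws \<subseteq> carrier (dihedral_group m)" for ws
      using that by (induction ws) auto
    have "?prod (take i xs) \<otimes>\<^bsub>dihedral_group m\<^esub> ?prod zs = ?prod (take i xs)"
      using eq foldr_mult_append[OF sub] by (simp add: partial_product_def take)
    then have "?prod zs = \<one>\<^bsub>dihedral_group m\<^esub>"
      using closed[OF sub(1)] closed[OF sub(2)] by (simp add: r_cancel_one)
    then have "signed_sum fst zs mod int m = 0" "sum_list (map snd zs) mod 2 = 0"
      unfolding foldr_dihedral[OF sub(2) assms(1)] by (auto simp: dihedral_group_def)
    moreover have "zs \<noteq> []"
      using ij len by (simp add: zs_def)
    ultimately show False
      using zs[OF split] by (simp add: even_iff_mod_2_eq_zero dvd_eq_mod_eq_0)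
  qed
  then have "inj_on (partial_product (dihedral_group m) xs) {0..card S}"
    by (intro linorder_inj_onI') auto
  then show ?thesis
    using xs by (simp add: linear_sequencing_def)
qed

text \<open>
  The coefficients depend on the list alone, which is what transfers the vanishing of a signed sum
  from one weight to another.
\<close>

lemma signed_sum_combination:
  assumes "distinct zs"
  obtains l :: "'a \<times> nat \<Rightarrow> int" where "\<And>s. \<bar>l s\<bar> \<le> 1"
    and "\<And>f S. finite S \<Longrightarrow> set zs \<subseteq> S \<Longrightarrow> signed_sum f zs = (\<Sum>s\<in>S. l s * f s)"
proof -
  have "\<exists>l :: 'a \<times> nat \<Rightarrow> int. (\<forall>s. \<bar>l s\<bar> \<le> 1) \<and> (\<forall>s. s \<notin> set zs \<longrightarrow> l s = 0) \<and>
      (\<forall>f. signed_sum f zs = (\<Sum>s\<in>set zs. l s * f s))"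
    using assms
  proof (induction zs)
    case Nil
    show ?case by (rule exI[of _ "\<lambda>_. 0"]) simp
  next
    case (Cons t zs)
    then obtain l :: "'a \<times> nat \<Rightarrow> int" where l: "\<And>s. \<bar>l s\<bar> \<le> 1" "\<And>s. s \<notin> set zs \<Longrightarrow> l s = 0"
      "\<And>f. signed_sum f zs = (\<Sum>s\<in>set zs. l s * f s)" by auto
    define l' where "l' = (\<lambda>s. (-1) ^ snd t * l s)(t := 1)"
    have "(\<Sum>s\<in>set zs. l' s * f s) = (-1) ^ snd t * (\<Sum>s\<in>set zs. l s * f s)" for f
      unfolding sum_distrib_left using Cons.prems
      by (intro sum.cong refl) (auto simp: l'_def)
    then have "signed_sum f (t # zs) = (\<Sum>s\<in>set (t # zs). l' s * f s)" for f
      using Cons.prems by (simp add: l(3)) (simp add: l'_def)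
    moreover have "\<bar>l' s\<bar> \<le> 1" for s
      using l(1)[of s] by (simp add: l'_def abs_mult power_abs)
    moreover have "l' s = 0" if "s \<notin> set (t # zs)" for s
      using l(2)[of s] that by (simp add: l'_def)
    ultimately show ?case by blast
  qed
  then obtain l :: "'a \<times> nat \<Rightarrow> int" where l: "\<And>s. \<bar>l s\<bar> \<le> 1" "\<And>s. s \<notin> set zs \<Longrightarrow> l s = 0"
      "\<And>f. signed_sum f zs = (\<Sum>s\<in>set zs. l s * f s)" by auto
  have "signed_sum f zs = (\<Sum>s\<in>S. l s * f s)" if "finite S" "set zs \<subseteq> S" for f S
    unfolding l(3) using that by (intro sum.mono_neutral_left) (auto simp: l(2))
  then show thesis by (rule that[OF l(1)])
qed

section \<open>Orderings over the integers: at least one reflection\<close>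

text \<open>
  The number \<open>a\<close> counts the reflections used so far, so that \<open>(-1) ^ a * w s\<close> is the change of the
  first coordinate on multiplying by \<open>s\<close>.
\<close>

fun rising :: "('a \<times> nat \<Rightarrow> int) \<Rightarrow> nat \<Rightarrow> ('a \<times> nat) list \<Rightarrow> bool" where
  "rising w a [] \<longleftrightarrow> True"
| "rising w a (s # zs) \<longleftrightarrow> (-1) ^ a * w s > 0 \<and> rising w (a + snd s) zs"

lemma rising_append:
  "rising w a (us @ vs) \<longleftrightarrow> rising w a us \<and> rising w (a + sum_list (map snd us)) vs"
  by (induction us arbitrary: a) (auto simp: add.assoc)

lemma rising_signed_sum_pos:
  "rising w a zs \<Longrightarrow> zs \<noteq> [] \<Longrightarrow> (-1) ^ a * signed_sum w zs > 0"
proof (induction zs arbitrary: a)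
  case (Cons s zs)
  then have "(-1) ^ (a + snd s) * signed_sum w zs \<ge> 0"
    by (cases "zs = []") (auto intro: less_imp_le)
  then have "(-1) ^ a * w s + (-1) ^ (a + snd s) * signed_sum w zs > 0"
    using Cons.prems by simp
  then show ?case by (simp add: distrib_left power_add mult.assoc)
qed simp

lemma rising_constant:
  assumes "\<And>s. s \<in> set zs \<Longrightarrow> snd s = 0 \<and> (-1) ^ a * w s > 0"
  shows "rising w a zs"
  using assms
proof (induction zs)
  case (Cons s zs)
  have "rising w a zs" using Cons by simp
  then show ?case using Cons.prems[of s] by simp
qed simp

lemma rising_splice:
  assumes "\<And>s. s \<in> set us \<Longrightarrow> snd s = 1 \<and> (-1) ^ a * w s > 0"
    and "\<And>s. s \<in> set vs \<Longrightarrow> snd s = 1 \<and> (-1) ^ Suc a * w s > 0"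
    and "length us = length vs \<or> length us = Suc (length vs)"
  shows "rising w a (splice us vs)"
  using assms
proof (induction us vs arbitrary: a rule: splice.induct)
  case (2 u us vs)
  have "rising w (Suc a) (splice vs us)"
    using "2.prems" by (intro "2.IH") auto
  then show ?case using "2.prems"(1)[of u] by simp
qed auto

text \<open>
  Shifting all reflections by the same amount is an automorphism of the infinite dihedral group, so it
  does not change products with an even number of reflections. The factor 2 makes room for a half-integral
  shift, after which no reflection has weight zero.
\<close>

lemma signed_sum_shift:
  fixes c :: int
  assumes "\<And>s. s \<in> set zs \<Longrightarrow> snd s < 2"
  shows "signed_sum (\<lambda>s. 2 * y s - c * int (snd s)) zs =
    2 * signed_sum y zs - c * int (sum_list (map snd zs) mod 2)"
  using assms
proof (induction zs)
  case (Cons s zs)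
  have flip: "int (Suc n mod 2) = 1 - int (n mod 2)" for n
    by (cases "even n") (auto simp: even_iff_mod_2_eq_zero odd_iff_mod_2_eq_one mod_Suc)
  have IH: "signed_sum (\<lambda>s. 2 * y s - c * int (snd s)) zs =
      2 * signed_sum y zs - c * int (sum_list (map snd zs) mod 2)"
    using Cons by simp
  have "snd s = 0 \<or> snd s = 1" using Cons.prems[of s] by auto
  then show ?case
    by (auto simp: IH flip) (simp add: algebra_simps)
qed simp

lemma threshold_exists:
  fixes y :: "'a \<Rightarrow> int"
  assumes "finite B" and "inj_on y B" and "n \<le> card B"
  shows "\<exists>c. card {s \<in> B. y s \<ge> c} = n"
  using assms(3)
proof (induction n)
  case 0
  have "y s < Max (insert 0 (y ` B)) + 1" if "s \<in> B" for s
    using that assms(1) by (auto simp: less_iff_succ_less_eq[symmetric] zle_add1_eq_le intro!: Max_ge)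
  then have "{s \<in> B. y s \<ge> Max (insert 0 (y ` B)) + 1} = {}" by fastforce
  then show ?case by (metis card.empty)
next
  case (Suc n)
  then obtain c where c: "card {s \<in> B. y s \<ge> c} = n" by auto
  define L where "L = {s \<in> B. y s < c}"
  have "B = {s \<in> B. y s \<ge> c} \<union> L" by (auto simp: L_def)
  then have "L \<noteq> {}" using c Suc.prems by auto
  moreover have "finite L" using assms(1) by (simp add: L_def)
  ultimately have "Max (y ` L) \<in> y ` L" and max: "\<And>s. s \<in> L \<Longrightarrow> y s \<le> Max (y ` L)" by auto
  then obtain t where t: "t \<in> L" "y t = Max (y ` L)" by auto
  have "{s \<in> B. y s \<ge> y t} = insert t {s \<in> B. y s \<ge> c}"
  proof (intro equalityI subsetI)
    fix s assume "s \<in> {s \<in> B. y s \<ge> y t}"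
    then show "s \<in> insert t {s \<in> B. y s \<ge> c}"
      using max[of s] t assms(2) by (force simp: L_def inj_on_def)
  qed (use t in \<open>auto simp: L_def\<close>)
  moreover have "t \<notin> {s \<in> B. y s \<ge> c}" using t by (simp add: L_def)
  ultimately have "card {s \<in> B. y s \<ge> y t} = Suc n"
    using c assms(1) by simp
  then show ?case by blast
qed

lemma ordering_with_reflection:
  fixes y :: "'a \<times> nat \<Rightarrow> int"
  assumes "finite S" and two: "\<And>s. s \<in> S \<Longrightarrow> snd s < 2"
    and rot: "\<And>s. s \<in> S \<Longrightarrow> snd s = 0 \<Longrightarrow> y s \<noteq> 0"
    and refl: "inj_on y {s \<in> S. snd s = 1}" "{s \<in> S. snd s = 1} \<noteq> {}"
  shows "\<exists>xs \<in> permutations_of_set S. \<forall>us zs vs. xs = us @ zs @ vs \<longrightarrow> zs \<noteq> [] \<longrightarrow>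
    even (sum_list (map snd zs)) \<longrightarrow> signed_sum y zs \<noteq> 0"
proof -
  define B where "B = {s \<in> S. snd s = 1}"
  have finB: "finite B" using assms(1) by (simp add: B_def)
  have "card B > 0" using finB refl(2) by (simp add: card_gt_0_iff B_def)
  obtain c where c: "card {s \<in> B. y s \<ge> c} = (card B + 1) div 2"
    using threshold_exists[OF finB, of y "(card B + 1) div 2"] refl(1)[folded B_def] \<open>card B > 0\<close>
    by fastforce
  \<comment> \<open>The odd number \<open>2 * c - 1\<close> lies strictly between the doubled values of the two halves.\<close>
  define w where "w = (\<lambda>s. 2 * y s - (2 * c - 1) * int (snd s))"
  have wB: "w s > 0 \<longleftrightarrow> y s \<ge> c" "w s < 0 \<longleftrightarrow> y s < c" if "s \<in> B" for s
    using that by (auto simp: w_def B_def)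
  define P where "P = {s \<in> S. snd s = 0 \<and> w s > 0}"
  define N where "N = {s \<in> S. snd s = 0 \<and> w s < 0}"
  define U where "U = {s \<in> B. y s \<ge> c}"
  define L where "L = {s \<in> B. y s < c}"
  have fin: "finite P" "finite N" "finite U" "finite L"
    using assms(1) finB by (auto simp: P_def N_def U_def L_def)
  have "B = U \<union> L" "U \<inter> L = {}" by (auto simp: U_def L_def)
  then have "card B = card U + card L" using card_Un_disjoint[OF fin(3,4)] by simp
  then have card: "card U = card L \<or> card U = Suc (card L)" "card U > 0"
    using c[folded U_def] \<open>card B > 0\<close> by linarith+
  have "s \<in> P \<union> N \<union> U \<union> L" if "s \<in> S" for s
    using two[OF that] rot[OF that] that
    by (cases "snd s = 0") (auto simp: P_def N_def U_def L_def B_def w_def less_2_cases_iff)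
  moreover have "P \<union> N \<union> U \<union> L \<subseteq> S"
    by (auto simp: P_def N_def U_def L_def B_def)
  ultimately have S: "S = P \<union> N \<union> U \<union> L" by blast
  obtain ps where ps: "set ps = P" "distinct ps" using finite_distinct_list[OF fin(1)] by blast
  obtain ns where ns: "set ns = N" "distinct ns" using finite_distinct_list[OF fin(2)] by blast
  obtain us where us: "set us = U" "distinct us" using finite_distinct_list[OF fin(3)] by blast
  obtain ls where ls: "set ls = L" "distinct ls" using finite_distinct_list[OF fin(4)] by blast
  have len: "length us = card U" "length ls = card L"
    using us ls distinct_card by fastforce+
  then obtain u us' where u: "us = u # us'"
    using card(2) by (cases us) auto
  define xs where "xs = ps @ u # ns @ splice ls us'"
  have "mset xs = mset ps + mset us + mset ns + mset ls"
    unfolding xs_def u using mset_shuffles[OF splice_in_shuffles[of ls us']] by simp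
  moreover have "distinct (ps @ us @ ns @ ls)"
    using ps ns us ls by (auto simp: P_def N_def U_def L_def B_def)
  ultimately have "mset xs = mset (ps @ us @ ns @ ls)" "distinct (ps @ us @ ns @ ls)" by simp_all
  then have "distinct xs" "set xs = S"
    using S ps ns us ls mset_eq_imp_distinct_iff[of xs "ps @ us @ ns @ ls"]
      mset_eq_setD[of xs "ps @ us @ ns @ ls"] by auto
  then have perm: "xs \<in> permutations_of_set S" by (simp add: permutations_of_set_def)
  have "rising w 0 ps"
    using ps by (intro rising_constant) (auto simp: P_def)
  moreover have "sum_list (map snd ps) = 0"
    using ps by (auto simp: P_def)
  moreover have "u \<in> U" using us(1) u by auto
  then have "w u > 0" "snd u = 1"
    using wB(1)[of u] by (auto simp: U_def B_def)
  moreover have "rising w 1 ns"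
    using ns by (intro rising_constant) (auto simp: N_def)
  moreover have "sum_list (map snd ns) = 0"
    using ns by (auto simp: N_def)
  moreover have "rising w 1 (splice ls us')"
  proof (rule rising_splice)
    show "length ls = length us' \<or> length ls = Suc (length us')"
      using card len u by auto
  qed (use us ls u wB in \<open>auto simp: U_def L_def B_def\<close>)
  ultimately have rise: "rising w 0 xs"
    by (simp add: xs_def rising_append del: sum_list_eq_0_iff)
  have "signed_sum y zs \<noteq> 0"
    if xs: "xs = as @ zs @ bs" and "zs \<noteq> []" and even: "even (sum_list (map snd zs))" for as zs bs
  proof -
    have "rising w (sum_list (map snd as)) zs"
      using rise by (simp add: xs rising_append)
    then have "signed_sum w zs \<noteq> 0"
      using rising_signed_sum_pos[of w _ zs] that(2) by fastforce
    moreover have "\<And>s. s \<in> set zs \<Longrightarrow> snd s < 2"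
      using two \<open>set xs = S\<close> by (auto simp: xs)
    then have "signed_sum w zs = 2 * signed_sum y zs"
      using signed_sum_shift[of zs y "2 * c - 1"] even by (simp add: w_def)
    ultimately show ?thesis by simp
  qed
  then show ?thesis using perm by blast
qed

section \<open>Orderings over the integers: rotations only\<close>

text \<open>
  Put an element \<open>p\<close> of the set with the larger total last: the prefix completed by \<open>p\<close> exceeds every
  prefix sum on the other side, so only the shorter orders matter. The induction needs their totals to
  differ, which rules out at most one choice of \<open>p\<close> by injectivity.
\<close>

lemma orders_without_common_prefix_sum:
  fixes g :: "'a \<Rightarrow> int"
  assumes "finite A" "finite B" "inj_on g A" "inj_on g B"
    and "\<And>s. s \<in> A \<union> B \<Longrightarrow> g s > 0" and "sum g A \<noteq> sum g B"
  shows "\<exists>as \<in> permutations_of_set A. \<exists>bs \<in> permutations_of_set B.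
    \<forall>i j. take i as \<noteq> [] \<or> take j bs \<noteq> [] \<longrightarrow>
      sum_list (map g (take i as)) \<noteq> sum_list (map g (take j bs))"
  using assms
proof (induction "card A + card B" arbitrary: A B rule: less_induct)
  case less
  \<comment> \<open>The statement is symmetric in \<open>A\<close> and \<open>B\<close>; this is the step for the larger total on the left.\<close>
  have main: "\<exists>as \<in> permutations_of_set A. \<exists>bs \<in> permutations_of_set B.
      \<forall>i j. take i as \<noteq> [] \<or> take j bs \<noteq> [] \<longrightarrow>
        sum_list (map g (take i as)) \<noteq> sum_list (map g (take j bs))"
    if IH: "\<And>p. p \<in> A \<Longrightarrow> sum g (A - {p}) \<noteq> sum g B \<Longrightarrow>
        \<exists>as \<in> permutations_of_set (A - {p}). \<exists>bs \<in> permutations_of_set B.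
        \<forall>i j. take i as \<noteq> [] \<or> take j bs \<noteq> [] \<longrightarrow>
        sum_list (map g (take i as)) \<noteq> sum_list (map g (take j bs))"
      and fin: "finite A" "finite B" and inj: "inj_on g A" and pos: "\<And>s. s \<in> A \<union> B \<Longrightarrow> g s > 0"
      and less: "sum g B < sum g A"
    for A B :: "'a set"
  proof (cases "\<exists>p\<in>A. sum g (A - {p}) \<noteq> sum g B")
    case True
    then obtain p where p: "p \<in> A" "sum g (A - {p}) \<noteq> sum g B" by blast
    from IH[OF this] obtain as bs where as: "as \<in> permutations_of_set (A - {p})"
      and bs: "bs \<in> permutations_of_set B"
      and ne: "\<And>i j. take i as \<noteq> [] \<or> take j bs \<noteq> [] \<Longrightarrow>
        sum_list (map g (take i as)) \<noteq> sum_list (map g (take j bs))" by metis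
    have "as @ [p] \<in> permutations_of_set A"
      using as p(1) by (auto simp: permutations_of_set_def)
    moreover have total: "sum_list (map g (as @ [p])) = sum g A"
      using calculation by (auto simp: permutations_of_set_def sum_list_distinct_conv_sum_set)
    have le: "sum_list (map g (take j bs)) \<le> sum g B" for j
    proof -
      have "sum_list (map g (take j bs)) = sum g (set (take j bs))"
        using bs by (auto simp: permutations_of_set_def sum_list_distinct_conv_sum_set)
      also have "\<dots> \<le> sum g B"
        using bs pos fin set_take_subset[of j bs]
        by (intro sum_mono2) (auto simp: permutations_of_set_def intro: less_imp_le)
      finally show ?thesis .
    qed
    have "sum_list (map g (take i (as @ [p]))) \<noteq> sum_list (map g (take j bs))"
      if "take i (as @ [p]) \<noteq> [] \<or> take j bs \<noteq> []" for i j
    proof (cases "i \<le> length as")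
      case True
      then show ?thesis using ne[of i j] that by simp
    next
      case False
      then show ?thesis using le[of j] total less by simp
    qed
    ultimately show ?thesis using bs by blast
  next
    case False
    \<comment> \<open>All elements of \<open>A\<close> have the same weight, so \<open>A\<close> is a singleton and \<open>B\<close> is empty.\<close>
    have "A \<noteq> {}" using less pos sum_nonneg[of B g] by (force intro: less_imp_le)
    then obtain p where p: "p \<in> A" by blast
    have diff: "sum g A - g q = sum g B" if "q \<in> A" for q
      using False that fin(1) by (simp add: sum_diff1)
    have "q = p" if "q \<in> A" for q
      using diff[OF that] diff[OF p] inj p that by (auto simp: inj_on_def)
    then have A: "A = {p}" using p by blast
    then have "sum g B = 0" using diff[OF p] by simp
    then have "B = {}"
      using sum_pos[of B g] fin pos by force
    then have "[p] \<in> permutations_of_set A" "[] \<in> permutations_of_set B"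
      by (auto simp: A)
    moreover have "g p > 0" using pos p by blast
    then have "sum_list (map g (take i [p])) \<noteq> 0" if "take i [p] \<noteq> []" for i
      using that by (cases i) auto
    ultimately show ?thesis by (intro bexI[of _ "[p]"] bexI[of _ "[]"]) auto
  qed
  show ?case
  proof (cases "sum g B < sum g A")
    case True
    show ?thesis
    proof (rule main)
      fix p assume "p \<in> A" "sum g (A - {p}) \<noteq> sum g B"
      moreover have "card (A - {p}) < card A"
        using \<open>p \<in> A\<close> less.prems(1) by (intro card_Diff1_less)
      ultimately show "\<exists>as \<in> permutations_of_set (A - {p}). \<exists>bs \<in> permutations_of_set B.
        \<forall>i j. take i as \<noteq> [] \<or> take j bs \<noteq> [] \<longrightarrow>
        sum_list (map g (take i as)) \<noteq> sum_list (map g (take j bs))"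
        using less.prems by (intro less.hyps) (auto intro: inj_on_subset)
    qed (use less.prems True in auto)
  next
    case False
    have "\<exists>bs \<in> permutations_of_set B. \<exists>as \<in> permutations_of_set A.
      \<forall>i j. take i bs \<noteq> [] \<or> take j as \<noteq> [] \<longrightarrow>
        sum_list (map g (take i bs)) \<noteq> sum_list (map g (take j as))"
    proof (rule main)
      fix p assume "p \<in> B" "sum g (B - {p}) \<noteq> sum g A"
      moreover have "card (B - {p}) < card B"
        using \<open>p \<in> B\<close> less.prems(2) by (intro card_Diff1_less)
      ultimately show "\<exists>bs \<in> permutations_of_set (B - {p}). \<exists>as \<in> permutations_of_set A.
        \<forall>i j. take i bs \<noteq> [] \<or> take j as \<noteq> [] \<longrightarrow>
        sum_list (map g (take i bs)) \<noteq> sum_list (map g (take j as))"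
        using less.prems by (intro less.hyps) (auto intro: inj_on_subset)
    qed (use less.prems False in auto)
    then show ?thesis by metis
  qed
qed

lemma ordering_of_rotations:
  fixes y :: "'a \<times> nat \<Rightarrow> int"
  assumes "finite S" and zero: "\<And>s. s \<in> S \<Longrightarrow> snd s = 0"
    and "inj_on y S" and "\<And>s. s \<in> S \<Longrightarrow> y s \<noteq> 0" and "sum y S \<noteq> 0"
  shows "\<exists>xs \<in> permutations_of_set S. \<forall>us zs vs. xs = us @ zs @ vs \<longrightarrow> zs \<noteq> [] \<longrightarrow>
    signed_sum y zs \<noteq> 0"
proof -
  define A where "A = {s \<in> S. y s > 0}"
  define B where "B = {s \<in> S. y s < 0}"
  have S: "S = A \<union> B" "A \<inter> B = {}"
    using assms(4) by (auto simp: A_def B_def not_less_iff_gr_or_eq)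
  have fin: "finite A" "finite B" using assms(1) by (auto simp: A_def B_def)
  have "sum y S = sum y A + sum y B"
    using S fin by (simp add: sum.union_disjoint)
  also have "sum y A = (\<Sum>s\<in>A. \<bar>y s\<bar>)" by (intro sum.cong) (auto simp: A_def)
  also have "sum y B = - (\<Sum>s\<in>B. \<bar>y s\<bar>)"
    unfolding sum_negf[symmetric] by (intro sum.cong) (auto simp: B_def)
  finally have ne: "(\<Sum>s\<in>A. \<bar>y s\<bar>) \<noteq> (\<Sum>s\<in>B. \<bar>y s\<bar>)" using assms(5) by simp
  have inj: "inj_on (\<lambda>s. \<bar>y s\<bar>) A" "inj_on (\<lambda>s. \<bar>y s\<bar>) B"
    using assms(3) by (auto simp: inj_on_def A_def B_def)
  obtain as bs where as: "as \<in> permutations_of_set A" and bs: "bs \<in> permutations_of_set B"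
    and pre: "\<And>i j. take i as \<noteq> [] \<or> take j bs \<noteq> [] \<Longrightarrow>
      (\<Sum>s\<leftarrow>take i as. \<bar>y s\<bar>) \<noteq> (\<Sum>s\<leftarrow>take j bs. \<bar>y s\<bar>)"
    using orders_without_common_prefix_sum[OF fin inj _ ne] assms(4) S by (metis zero_less_abs_iff)
  have sets: "set as = A" "set bs = B"
    using as bs by (auto simp: permutations_of_set_def)
  have perm: "rev as @ bs \<in> permutations_of_set S"
    using as bs S by (auto simp: permutations_of_set_def)
  have sum: "signed_sum y zs = (\<Sum>s\<leftarrow>zs. y s)" if "set zs \<subseteq> S" for zs
    using that by (induction zs) (auto simp: zero)
  have sumA: "(\<Sum>s\<leftarrow>zs. y s) = (\<Sum>s\<leftarrow>zs. \<bar>y s\<bar>)" if "set zs \<subseteq> A" for zs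
    using that by (induction zs) (auto simp: A_def)
  have sumB: "(\<Sum>s\<leftarrow>zs. y s) = - (\<Sum>s\<leftarrow>zs. \<bar>y s\<bar>)" if "set zs \<subseteq> B" for zs
    using that by (induction zs) (auto simp: B_def)
  have pos: "(\<Sum>s\<leftarrow>zs. \<bar>y s\<bar>) > 0" if "set zs \<subseteq> S" "zs \<noteq> []" for zs
    using that
  proof (induction zs)
    case (Cons s zs)
    have "(\<Sum>s\<leftarrow>zs. \<bar>y s\<bar>) \<ge> 0" by (intro sum_list_nonneg) auto
    then show ?case using Cons.prems assms(4)[of s] by simp
  qed simp
  have "signed_sum y zs \<noteq> 0" if eq: "rev as @ bs = us @ zs @ vs" and "zs \<noteq> []" for us zs vs
  proof -
    have "set us \<union> set zs \<union> set vs = S"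
      using arg_cong[OF eq, of set] sets S by auto
    then have zS: "set zs \<subseteq> S" by blast
    consider t w where "rev as = us @ t" "zs = t @ w" "bs = w @ vs"
      | "set zs \<subseteq> A" | "set zs \<subseteq> B"
    proof -
      from eq consider t where "rev as = us @ t" "t @ bs = zs @ vs" | t where "bs = t @ zs @ vs"
        by (auto simp: append_eq_append_conv2)
      then show thesis
      proof cases
        case 1
        from 1(2) consider w where "t = zs @ w" | w where "zs = t @ w" "bs = w @ vs"
          by (auto simp: append_eq_append_conv2)
        then show thesis
        proof cases
          case (1 w)
          then have "set (rev as) = set us \<union> set zs \<union> set w"
            using \<open>rev as = us @ t\<close> by auto
          then show thesis using sets that(2) by auto
        next
          case (2 w)
          then show thesis using 1(1) that(1) by blast
        qed
      next
        case (2 t)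
        then show thesis using sets that(3) by auto
      qed
    qed
    then show ?thesis
    proof cases
      case (1 t w)
      have "as = rev t @ rev us" using arg_cong[OF 1(1), of rev] by simp
      then have t: "rev t = take (length t) as" by simp
      have w: "w = take (length w) bs" using 1(3) by simp
      have "(\<Sum>s\<leftarrow>rev t. \<bar>y s\<bar>) \<noteq> (\<Sum>s\<leftarrow>w. \<bar>y s\<bar>)"
        using pre[of "length t" "length w"] 1(2) \<open>zs \<noteq> []\<close> by (auto simp flip: t w)
      moreover have "set t \<subseteq> A" "set w \<subseteq> B"
        using arg_cong[OF 1(1), of set] arg_cong[OF 1(3), of set] sets by auto
      ultimately show ?thesis
        using sum[OF zS] by (simp add: 1(2) sumA sumB sum_list_rev flip: rev_map)
    next
      case 2
      then show ?thesis using sum[OF zS] sumA pos[OF zS \<open>zs \<noteq> []\<close>] by simp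
    next
      case 3
      then show ?thesis using sum[OF zS] sumB pos[OF zS \<open>zs \<noteq> []\<close>] by simp
    qed
  qed
  then show ?thesis using perm by blast
qed

section \<open>Sequencings in dihedral groups\<close>

theorem mainTheorem4:
  fixes k m :: nat and S :: "(int \<times> nat) set"
  assumes "k \<le> 12"
    and "m > 0"
    and "\<And>p :: nat. prime p \<Longrightarrow> p dvd m \<Longrightarrow> p > fact k"
    and "S \<subseteq> carrier (dihedral_group m) - {\<one>\<^bsub>dihedral_group m\<^esub>}"
    and "card S = k"
  shows "(dihedral_type S \<noteq> (k, 0) \<longrightarrow>
            (\<exists>xs. linear_sequencing (dihedral_group m) S xs)) \<and>
         ((\<exists>xs \<in> permutations_of_set S.
             partial_product (dihedral_group m) xs k \<noteq> \<one>\<^bsub>dihedral_group m\<^esub>) \<longrightarrow>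
            (\<exists>xs. linear_sequencing (dihedral_group m) S xs))"
proof -
  have carrier: "S \<subseteq> carrier (dihedral_group m)" using assms(4) by blast
  have S: "0 \<le> fst s \<and> fst s < int m \<and> snd s < 2" if "s \<in> S" for s
    using subsetD[OF carrier that] by (auto simp: dihedral_group_def)
  have not_one: "s \<noteq> (0, 0)" if "s \<in> S" for s
    using that assms(4) by (auto simp: dihedral_group_def)
  have fin: "finite S"
    using carrier by (rule finite_subset) (simp add: dihedral_group_def)
  have primes: "p > fact (card S)" if "prime p" "p dvd m" for p :: nat
    using assms(3,5) that by simp
  obtain y :: "int \<times> nat \<Rightarrow> int" where y: "\<forall>l. (\<forall>s\<in>S. \<bar>l s\<bar> \<le> 1) \<longrightarrow>
      ((\<Sum>s\<in>S. l s * y s) = 0 \<longleftrightarrow> int m dvd (\<Sum>s\<in>S. l s * fst s))"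
    using lift_relations[OF fin primes, where x = fst] by blast
  have signed: "signed_sum y zs = 0 \<longleftrightarrow> int m dvd signed_sum fst zs"
    if zs: "distinct zs" "set zs \<subseteq> S" for zs
  proof -
    obtain l :: "int \<times> nat \<Rightarrow> int" where "\<And>s. \<bar>l s\<bar> \<le> 1"
      and "\<And>f S. finite S \<Longrightarrow> set zs \<subseteq> S \<Longrightarrow> signed_sum f zs = (\<Sum>s\<in>S. l s * f s)"
      using signed_sum_combination[OF zs(1)] by blast
    then show ?thesis using y[rule_format, of l] fin zs(2) by simp
  qed
  have small: "d = 0" if "int m dvd d" "\<bar>d\<bar> < int m" for d :: int
    using that dvd_imp_le_int[of d "int m"] by auto
  have inj: "s = t" if "s \<in> S" "t \<in> S" "snd s = snd t" "y s = y t" for s t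
  proof (rule ccontr)
    assume "s \<noteq> t"
    define l :: "int \<times> nat \<Rightarrow> int" where "l = (\<lambda>q. if q = s then 1 else if q = t then -1 else 0)"
    have "(\<Sum>q\<in>S. l q * f q) = (\<Sum>q\<in>{s, t}. l q * f q)" for f
      using that fin by (intro sum.mono_neutral_right) (auto simp: l_def)
    then have l: "(\<Sum>q\<in>S. l q * f q) = f s - f t" for f
      using \<open>s \<noteq> t\<close> by (simp add: l_def)
    have "int m dvd fst s - fst t"
      using y[rule_format, of l] that(4) unfolding l by (simp add: l_def)
    then have "fst s = fst t" using small[of "fst s - fst t"] S[OF that(1)] S[OF that(2)] by auto
    then show False using \<open>s \<noteq> t\<close> that(3) by (simp add: prod_eq_iff)
  qed
  have nonzero: "y s \<noteq> 0" if "s \<in> S" "snd s = 0" for s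
    using signed[of "[s]"] small[of "fst s"] S[OF that(1)] not_one[OF that(1)] that
    by (auto simp: prod_eq_iff)
  have sequencing: "linear_sequencing (dihedral_group m) S xs"
    if xs: "xs \<in> permutations_of_set S"
      and ne: "\<And>us zs vs. xs = us @ zs @ vs \<Longrightarrow> zs \<noteq> [] \<Longrightarrow> even (sum_list (map snd zs)) \<Longrightarrow>
        signed_sum y zs \<noteq> 0" for xs
  proof (rule linear_sequencing_dihedralI[OF assms(2) carrier xs])
    fix us zs vs assume *: "xs = us @ zs @ vs" "zs \<noteq> []" "even (sum_list (map snd zs))"
    then have "distinct zs" "set zs \<subseteq> S"
      using xs by (auto simp: permutations_of_set_def)
    then show "\<not> int m dvd signed_sum fst zs" using signed ne[OF *] by blast
  qed
  have reflections: "\<exists>xs. linear_sequencing (dihedral_group m) S xs" if "{s \<in> S. snd s = 1} \<noteq> {}"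
  proof -
    have "inj_on y {s \<in> S. snd s = 1}" using inj by (intro inj_onI) auto
    then have "\<exists>xs \<in> permutations_of_set S. \<forall>us zs vs. xs = us @ zs @ vs \<longrightarrow> zs \<noteq> [] \<longrightarrow>
        even (sum_list (map snd zs)) \<longrightarrow> signed_sum y zs \<noteq> 0"
      using S by (intro ordering_with_reflection fin nonzero that) auto
    then show ?thesis using sequencing by blast
  qed
  have rotations: "\<exists>xs. linear_sequencing (dihedral_group m) S xs"
    if none: "{s \<in> S. snd s = 1} = {}" and zs: "zs \<in> permutations_of_set S"
      and prod: "partial_product (dihedral_group m) zs k \<noteq> \<one>\<^bsub>dihedral_group m\<^esub>" for zs
  proof -
    have zero: "snd s = 0" if "s \<in> S" for s
    proof -
      have "snd s \<noteq> 1" using none that by blast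
      then show ?thesis using S[OF that] by linarith
    qed
    have set: "set zs = S" "distinct zs" using zs by (auto simp: permutations_of_set_def)
    then have "length zs = k" using assms(5) distinct_card by fastforce
    then have "(signed_sum fst zs mod int m, sum_list (map snd zs) mod 2) \<noteq> (0, 0)"
      using prod foldr_dihedral[of zs m] assms(2) carrier set
      by (simp add: partial_product_def dihedral_group_def)
    moreover have "sum_list (map snd zs) = 0" using zero set by simp
    ultimately have "signed_sum y zs \<noteq> 0"
      using signed[of zs] set by (auto simp: dvd_eq_mod_eq_0)
    moreover have "signed_sum y ws = (\<Sum>s\<leftarrow>ws. y s)" if "set ws \<subseteq> S" for ws
      using that by (induction ws) (auto simp: zero)
    ultimately have "sum y S \<noteq> 0"
      using set by (auto simp: sum_list_distinct_conv_sum_set)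
    moreover have "inj_on y S" using inj zero by (intro inj_onI) auto
    ultimately have "\<exists>xs \<in> permutations_of_set S. \<forall>us zs vs. xs = us @ zs @ vs \<longrightarrow> zs \<noteq> [] \<longrightarrow>
        signed_sum y zs \<noteq> 0"
      using zero nonzero by (intro ordering_of_rotations fin) auto
    then show ?thesis using sequencing by blast
  qed
  have "{s \<in> S. snd s = 1} \<noteq> {}" if "dihedral_type S \<noteq> (k, 0)"
  proof
    assume none: "{s \<in> S. snd s = 1} = {}"
    then have "{s \<in> S. snd s = 0} = S" using S by (force simp: less_2_cases_iff)
    then show False using that assms(5) unfolding dihedral_type_def none by simp
  qed
  then show ?thesis using reflections rotations by blast
qed

end
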